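(* For every real number $x\ge 1$, $$\exp\biggl(\frac{1}{240x^{3}}-\frac{11}{6720x^{5}}\biggr)<\frac{e^{x}\,\Gamma(x+1)}{x^{x}\sqrt{2\pi x}\,\exp\bigl(\frac{1}{12}\psi'\bigl(x+\frac{1}{2}\bigr)\bigr)}<\exp\biggl(\frac{1}{240x^{3}}\biggr).$$
   Context: $\Gamma$ is Euler's gamma function, $\Gamma(x)=\int_0^\infty t^{x-1}e^{-t}\,dt$ for $x>0$; $\psi(x)=\frac{d}{dx}\ln\Gamma(x)=\Gamma'(x)/\Gamma(x)$ is the di-gamma function, and its derivative $\psi'(x)$, $x>0$, is the tri-gamma function. *)

theory Defs
  imports "HOL-Analysis.Analysis"
begin

end

theory Submission
  imports Defs "HOL-Real_Asymp.Real_Asymp"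
begin

text \<open>
  Let $f(x)$ be the logarithm of the quotient and put $u = 1/(2x+1)$. The functional equations of
  $\Gamma$ and $\psi'$ give
  $f(x+1) - f(x) = 1 + u^2/3 - \frac{1}{2u} \ln\frac{1+u}{1-u}$. Rational bounds for the logarithm,
  obtained by differentiation, show that $f(x) - 1/(240x^3)$ increases strictly under $x \mapsto x+1$
  and that $f(x) - 1/(240x^3) + 11/(6720x^5)$ decreases strictly. Both tend to $0$ along $x + n$,
  which is Stirling's formula: convergence along $n$ follows from monotonicity, the limit is the
  same for all $x$ by Gauss' product for $\Gamma$, and its value comes from
  the duplication formula.
\<close>

section \<open>Rational bounds for the logarithm of (1 + u) / (1 - u)\<close>

lemma DERIV_pos_imp_pos:
  fixes f :: "real \<Rightarrow> real"
  assumes "0 < u" "f 0 = 0"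
    and "\<And>v. 0 \<le> v \<Longrightarrow> v \<le> u \<Longrightarrow> (f has_real_derivative f' v) (at v)"
    and "\<And>v. 0 < v \<Longrightarrow> v < u \<Longrightarrow> 0 < f' v"
  shows "0 < f u"
proof -
  have "f 0 < f u"
  proof (rule DERIV_pos_imp_increasing_open[OF assms(1)])
    show "continuous_on {0..u} f"
      using assms(3) by (intro DERIV_atLeastAtMost_imp_continuous_on) blast
    show "\<exists>y. DERIV f v :> y \<and> y > 0" if "0 < v" "v < u" for v
      using assms(3,4) that by (meson less_imp_le)
  qed
  with assms(2) show ?thesis by simp
qed

lemma one_minus_square_pos:
  fixes v :: real
  assumes "0 \<le> v" "v < 1"
  shows "0 < 1 - v\<^sup>2"
  using assms by (simp add: power_less_one_iff abs_square_less_1)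

lemma has_real_derivative_ln_diff:
  fixes v :: real
  assumes "0 \<le> v" "v < 1"
  shows "((\<lambda>v. ln (1 + v) - ln (1 - v)) has_real_derivative 2 / (1 - v\<^sup>2)) (at v)"
proof -
  have "1 / (1 + v) + 1 / (1 - v) = 2 / (1 - v\<^sup>2)"
    using assms one_minus_square_pos[OF assms] by (simp add: divide_simps) algebra
  then show ?thesis
    using assms by (auto intro!: derivative_eq_intros)
qed

text \<open>The quotient rule would give the denominator power 2n; cancelling the common factor
  leaves n + 1. This keeps the polynomial identities in the two rational bounds at low
  degree.\<close>

lemma has_real_derivative_divide_one_minus_square_power:
  fixes v :: real
  assumes "(N has_real_derivative N') (at v)" "1 - v\<^sup>2 \<noteq> 0"
  shows "((\<lambda>v. N v / (1 - v\<^sup>2) ^ n) has_real_derivative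
    (N' * (1 - v\<^sup>2) + 2 * real n * v * N v) / (1 - v\<^sup>2) ^ Suc n) (at v)"
proof (cases n)
  case 0
  with assms show ?thesis by simp
next
  case (Suc m)
  have "((\<lambda>v. N v / (1 - v\<^sup>2) ^ n) has_real_derivative
    (N' * (1 - v\<^sup>2) ^ n - N v * (real n * (1 - v\<^sup>2) ^ (n - 1) * (- 2 * v))) / ((1 - v\<^sup>2) ^ n * (1 - v\<^sup>2) ^ n)) (at v)"
    using assms by (auto intro!: derivative_eq_intros)
  also have "(N' * (1 - v\<^sup>2) ^ n - N v * (real n * (1 - v\<^sup>2) ^ (n - 1) * (- 2 * v))) / ((1 - v\<^sup>2) ^ n * (1 - v\<^sup>2) ^ n)
     = (N' * (1 - v\<^sup>2) + 2 * real n * v * N v) / (1 - v\<^sup>2) ^ Suc n"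
    using assms(2) by (simp add: Suc divide_simps) (simp add: algebra_simps)
  finally show ?thesis .
qed

text \<open>The left side is the cubic Taylor polynomial at 0, and the difference of the derivatives
  is 2 v^4 / (1 - v^2). The bound makes \<open>trigamma_remainder\<close> decrease under x \<mapsto>
  x + 1.\<close>

lemma ln_diff_cubic_lower:
  fixes u :: real
  assumes "0 < u" "u < 1"
  shows "2 * u + 2 * u ^ 3 / 3 < ln (1 + u) - ln (1 - u)"
proof -
  let ?f = "\<lambda>v::real. (ln (1 + v) - ln (1 - v)) - (2 * v + 2 * v ^ 3 / 3)"
  have "0 < ?f u"
  proof (rule DERIV_pos_imp_pos[OF assms(1)])
    show "(?f has_real_derivative 2 * v ^ 4 / (1 - v\<^sup>2)) (at v)" if "0 \<le> v" "v \<le> u" for v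
    proof -
      have "((\<lambda>v::real. 2 * v + 2 * v ^ 3 / 3) has_real_derivative 2 + 2 * v\<^sup>2) (at v)"
        by (auto intro!: derivative_eq_intros)
      moreover have "2 / (1 - v\<^sup>2) - (2 + 2 * v\<^sup>2) = 2 * v ^ 4 / (1 - v\<^sup>2)"
        using one_minus_square_pos[of v] that assms by (simp add: divide_simps) algebra
      ultimately show ?thesis
        using DERIV_diff[OF has_real_derivative_ln_diff[of v]] that assms by fastforce
    qed
    show "0 < 2 * v ^ 4 / (1 - v\<^sup>2)" if "0 < v" "v < u" for v
      using one_minus_square_pos[of v] that assms by simp
  qed simp
  then show ?thesis by simp
qed

text \<open>The rational term is 2u times the drop of 1 / (240 x^3) from x to x + 1, written in u.
  It starts with 2 u^5 / 5, the next Taylor term of the logarithm, so the derivative of the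
  difference starts at v^6.\<close>

lemma ln_diff_upper:
  fixes u :: real
  assumes "0 < u" "u < 1"
  shows "ln (1 + u) - ln (1 - u) <
    2 * u + 2 * u ^ 3 / 3 + (6 * u ^ 5 + 2 * u ^ 7) / (1 - u\<^sup>2) ^ 3 / 15"
proof -
  let ?R = "\<lambda>v::real. (6 * v ^ 5 + 2 * v ^ 7) / (1 - v\<^sup>2) ^ 3"
  let ?f = "\<lambda>v::real. (2 * v + 2 * v ^ 3 / 3 + ?R v / 15) - (ln (1 + v) - ln (1 - v))"
  let ?f' = "\<lambda>v::real. v ^ 6 * (110 - 92 * v\<^sup>2 + 30 * v ^ 4) / (15 * (1 - v\<^sup>2) ^ 4)"
  have "0 < ?f u"
  proof (rule DERIV_pos_imp_pos[OF assms(1)])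
    show "(?f has_real_derivative ?f' v) (at v)" if "0 \<le> v" "v \<le> u" for v
    proof -
      have v: "v < 1" and d: "1 - v\<^sup>2 \<noteq> 0"
        using one_minus_square_pos[of v] that assms by auto
      have "((\<lambda>v::real. 6 * v ^ 5 + 2 * v ^ 7) has_real_derivative 30 * v ^ 4 + 14 * v ^ 6) (at v)"
        by (auto intro!: derivative_eq_intros)
      note R = has_real_derivative_divide_one_minus_square_power[OF this d, of 3]
      have "((\<lambda>v::real. 2 * v + 2 * v ^ 3 / 3 + ?R v / 15) has_real_derivative
        2 + 2 * v\<^sup>2 + ((30 * v ^ 4 + 14 * v ^ 6) * (1 - v\<^sup>2)
          + 2 * real 3 * v * (6 * v ^ 5 + 2 * v ^ 7)) / (1 - v\<^sup>2) ^ Suc 3 / 15) (at v)"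
        by (intro DERIV_add DERIV_cdivide R) (auto intro!: derivative_eq_intros)
      note DERIV_diff[OF this has_real_derivative_ln_diff[OF that(1) v]]
      moreover have "2 + 2 * v\<^sup>2 + ((30 * v ^ 4 + 14 * v ^ 6) * (1 - v\<^sup>2)
          + 2 * real 3 * v * (6 * v ^ 5 + 2 * v ^ 7)) / (1 - v\<^sup>2) ^ Suc 3 / 15 - 2 / (1 - v\<^sup>2) = ?f' v"
      proof -
        \<comment> \<open>With \<open>d\<close> opaque, clearing denominators does not expand powers
          of \<open>1 - v\<^sup>2\<close>; the definition is needed only for the polynomial identity
          in the numerator.\<close>
        define d where "d = 1 - v\<^sup>2"
        have "d \<noteq> 0" using d by (simp add: d_def)
        then have "2 + 2 * v\<^sup>2 + ((30 * v ^ 4 + 14 * v ^ 6) * d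
          + 2 * real 3 * v * (6 * v ^ 5 + 2 * v ^ 7)) / d ^ Suc 3 / 15 - 2 / d
          = ((2 + 2 * v\<^sup>2) * 15 * d ^ 4 + ((30 * v ^ 4 + 14 * v ^ 6) * d
          + 6 * v * (6 * v ^ 5 + 2 * v ^ 7)) - 30 * d ^ 3) / (15 * d ^ 4)"
          by (simp add: field_simps eval_nat_numeral)
        also have "(2 + 2 * v\<^sup>2) * 15 * d ^ 4 + ((30 * v ^ 4 + 14 * v ^ 6) * d
          + 6 * v * (6 * v ^ 5 + 2 * v ^ 7)) - 30 * d ^ 3 = v ^ 6 * (110 - 92 * v\<^sup>2 + 30 * v ^ 4)"
          unfolding d_def by algebra
        finally show ?thesis by (simp only: d_def)
      qed
      ultimately show ?thesis by (simp only:)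
    qed
    show "0 < ?f' v" if "0 < v" "v < u" for v
    proof -
      have "0 < 1 - v\<^sup>2" using one_minus_square_pos[of v] that assms by simp
      moreover from this have "0 < 110 - 92 * v\<^sup>2 + 30 * v ^ 4"
        using zero_le_power[of v 4] that by linarith
      ultimately show ?thesis using that by simp
    qed
  qed simp
  then show ?thesis by simp
qed

text \<open>The second rational term comes from 11 / (6720 x^5) in the same way. The constant makes
  the u^7 coefficients agree, 4/3 - 22/21 = 2/7, so the derivative of the difference starts at
  v^8.\<close>

lemma ln_diff_lower:
  fixes u :: real
  assumes "0 < u" "u < 1"
  shows "2 * u + 2 * u ^ 3 / 3 + (6 * u ^ 5 + 2 * u ^ 7) / (1 - u\<^sup>2) ^ 3 / 15
      - (110 * u ^ 7 + 220 * u ^ 9 + 22 * u ^ 11) / (1 - u\<^sup>2) ^ 5 / 105 < ln (1 + u) - ln (1 - u)"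
proof -
  let ?R = "\<lambda>v::real. (6 * v ^ 5 + 2 * v ^ 7) / (1 - v\<^sup>2) ^ 3"
  let ?S = "\<lambda>v::real. (110 * v ^ 7 + 220 * v ^ 9 + 22 * v ^ 11) / (1 - v\<^sup>2) ^ 5"
  let ?f = "\<lambda>v::real. (ln (1 + v) - ln (1 - v)) - (2 * v + 2 * v ^ 3 / 3 + ?R v / 15 - ?S v / 105)"
  let ?f' = "\<lambda>v::real. v ^ 8 * (4494 - 1806 * v\<^sup>2 + 1042 * v ^ 4 - 210 * v ^ 6)
    / (105 * (1 - v\<^sup>2) ^ 6)"
  have "0 < ?f u"
  proof (rule DERIV_pos_imp_pos[OF assms(1)])
    show "(?f has_real_derivative ?f' v) (at v)" if "0 \<le> v" "v \<le> u" for v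
    proof -
      have v: "v < 1" and d: "1 - v\<^sup>2 \<noteq> 0"
        using one_minus_square_pos[of v] that assms by auto
      have "((\<lambda>v::real. 6 * v ^ 5 + 2 * v ^ 7) has_real_derivative 30 * v ^ 4 + 14 * v ^ 6) (at v)"
        by (auto intro!: derivative_eq_intros)
      note R = has_real_derivative_divide_one_minus_square_power[OF this d, of 3]
      have "((\<lambda>v::real. 110 * v ^ 7 + 220 * v ^ 9 + 22 * v ^ 11) has_real_derivative
          770 * v ^ 6 + 1980 * v ^ 8 + 242 * v ^ 10) (at v)"
        by (auto intro!: derivative_eq_intros)
      note S = has_real_derivative_divide_one_minus_square_power[OF this d, of 5]
      have "((\<lambda>v::real. 2 * v + 2 * v ^ 3 / 3 + ?R v / 15 - ?S v / 105) has_real_derivative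
        2 + 2 * v\<^sup>2 + ((30 * v ^ 4 + 14 * v ^ 6) * (1 - v\<^sup>2)
          + 2 * real 3 * v * (6 * v ^ 5 + 2 * v ^ 7)) / (1 - v\<^sup>2) ^ Suc 3 / 15
        - ((770 * v ^ 6 + 1980 * v ^ 8 + 242 * v ^ 10) * (1 - v\<^sup>2)
          + 2 * real 5 * v * (110 * v ^ 7 + 220 * v ^ 9 + 22 * v ^ 11)) / (1 - v\<^sup>2) ^ Suc 5 / 105) (at v)"
        by (intro DERIV_add DERIV_diff DERIV_cdivide R S) (auto intro!: derivative_eq_intros)
      note DERIV_diff[OF has_real_derivative_ln_diff[OF that(1) v] this]
      moreover have "2 / (1 - v\<^sup>2) - (2 + 2 * v\<^sup>2 + ((30 * v ^ 4 + 14 * v ^ 6) * (1 - v\<^sup>2)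
          + 2 * real 3 * v * (6 * v ^ 5 + 2 * v ^ 7)) / (1 - v\<^sup>2) ^ Suc 3 / 15
        - ((770 * v ^ 6 + 1980 * v ^ 8 + 242 * v ^ 10) * (1 - v\<^sup>2)
          + 2 * real 5 * v * (110 * v ^ 7 + 220 * v ^ 9 + 22 * v ^ 11)) / (1 - v\<^sup>2) ^ Suc 5 / 105) = ?f' v"
      proof -
        define d where "d = 1 - v\<^sup>2"
        have "d \<noteq> 0" using d by (simp add: d_def)
        then have "2 / d - (2 + 2 * v\<^sup>2 + ((30 * v ^ 4 + 14 * v ^ 6) * d
          + 2 * real 3 * v * (6 * v ^ 5 + 2 * v ^ 7)) / d ^ Suc 3 / 15
        - ((770 * v ^ 6 + 1980 * v ^ 8 + 242 * v ^ 10) * d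
          + 2 * real 5 * v * (110 * v ^ 7 + 220 * v ^ 9 + 22 * v ^ 11)) / d ^ Suc 5 / 105)
          = (210 * d ^ 5 - (2 + 2 * v\<^sup>2) * 105 * d ^ 6 - 7 * d\<^sup>2 * ((30 * v ^ 4 + 14 * v ^ 6) * d
          + 6 * v * (6 * v ^ 5 + 2 * v ^ 7)) + ((770 * v ^ 6 + 1980 * v ^ 8 + 242 * v ^ 10) * d
          + 10 * v * (110 * v ^ 7 + 220 * v ^ 9 + 22 * v ^ 11))) / (105 * d ^ 6)"
          by (simp add: field_simps eval_nat_numeral)
        also have "210 * d ^ 5 - (2 + 2 * v\<^sup>2) * 105 * d ^ 6 - 7 * d\<^sup>2 * ((30 * v ^ 4 + 14 * v ^ 6) * d
          + 6 * v * (6 * v ^ 5 + 2 * v ^ 7)) + ((770 * v ^ 6 + 1980 * v ^ 8 + 242 * v ^ 10) * d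
          + 10 * v * (110 * v ^ 7 + 220 * v ^ 9 + 22 * v ^ 11))
          = v ^ 8 * (4494 - 1806 * v\<^sup>2 + 1042 * v ^ 4 - 210 * v ^ 6)"
          unfolding d_def by algebra
        finally show ?thesis by (simp only: d_def)
      qed
      ultimately show ?thesis by (simp only:)
    qed
    show "0 < ?f' v" if "0 < v" "v < u" for v
    proof -
      have "0 < 1 - v\<^sup>2" "v ^ 6 < 1"
        using one_minus_square_pos[of v] that assms by (simp_all add: power_less_one_iff)
      moreover from this have "0 < 4494 - 1806 * v\<^sup>2 + 1042 * v ^ 4 - 210 * v ^ 6"
        using zero_le_power[of v 4] that by linarith
      ultimately show ?thesis using that by simp
    qed
  qed simp
  then show ?thesis by simp
qed

section \<open>Gamma and trigamma along x + n, and the duplication formula\<close>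

lemma Gamma_real_nonzero: "0 < x \<Longrightarrow> Gamma x \<noteq> (0 :: real)"
  by (auto simp: Gamma_eq_zero_iff)

text \<open>This is the logarithm of Gauss' product: for n > 0 the factorial in
  \<open>Gamma_series'\<close> is Gamma(n), and its Pochhammer symbol is Gamma(x + n) /
  Gamma(x).\<close>

lemma ln_Gamma_plus_nat_asymp:
  fixes x :: real
  assumes "0 < x"
  shows "(\<lambda>n. ln_Gamma (x + real n) - ln_Gamma (real n) - x * ln (real n)) \<longlonglongrightarrow> 0"
proof -
  have "(\<lambda>n. ln (Gamma x) - ln (Gamma_series' x n)) \<longlonglongrightarrow> ln (Gamma x) - ln (Gamma x)"
    using assms Gamma_real_nonzero by (intro tendsto_intros Gamma_series'_LIMSEQ)
  also have "ln (Gamma x) - ln (Gamma x) = 0" by simp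
  finally show ?thesis
  proof (rule Lim_transform_eventually)
    show "\<forall>\<^sub>F n in sequentially. ln (Gamma x) - ln (Gamma_series' x n)
        = ln_Gamma (x + real n) - ln_Gamma (real n) - x * ln (real n)"
      using eventually_gt_at_top[of 0]
    proof eventually_elim
      case (elim n)
      have "pochhammer x n = Gamma (x + real n) / Gamma x"
        using assms by (subst pochhammer_Gamma) auto
      then show ?case
        using elim assms Gamma_fact[of "n - 1", where 'a = real]
          Gamma_real_nonzero[of x] Gamma_real_nonzero[of "x + real n"]
        by (simp add: Gamma_series'_def ln_Gamma_real_pos ln_mult ln_div of_nat_diff)
    qed
  qed
qed

text \<open>The complex duplication formula is restricted to positive reals, where all factors are
  positive and logarithms may be taken.\<close>

lemma ln_Gamma_legendre_duplication:
  fixes x :: real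
  assumes "0 < x"
  shows "ln_Gamma x + ln_Gamma (x + 1 / 2) = (1 - 2 * x) * ln 2 + ln pi / 2 + ln_Gamma (2 * x)"
proof -
  have "complex_of_real (Gamma x * Gamma (x + 1 / 2))
     = of_real (exp ((1 - 2 * x) * ln 2) * sqrt pi * Gamma (2 * x))"
    using Gamma_legendre_duplication[of "of_real x"] Gamma_complex_of_real[of x]
      Gamma_complex_of_real[of "x + 1 / 2"] Gamma_complex_of_real[of "2 * x"] assms
      of_real_in_nonpos_Ints_iff[of x, where 'a = complex]
      of_real_in_nonpos_Ints_iff[of "x + 1 / 2", where 'a = complex]
    by (auto simp: exp_of_real[symmetric])
  then have "Gamma x * Gamma (x + 1 / 2) = exp ((1 - 2 * x) * ln 2) * sqrt pi * Gamma (2 * x)"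
    by (simp only: of_real_eq_iff)
  then have "ln (Gamma x * Gamma (x + 1 / 2)) = ln (exp ((1 - 2 * x) * ln 2) * sqrt pi * Gamma (2 * x))"
    by simp
  then show ?thesis
    using assms Gamma_real_nonzero[of x] Gamma_real_nonzero[of "x + 1 / 2"] Gamma_real_nonzero[of "2 * x"]
    by (simp add: ln_Gamma_real_pos ln_mult ln_sqrt)
qed

text \<open>The value at x + n is the tail from index n of the convergent series of 1 / (x +
  k)^2.\<close>

lemma Polygamma_1_plus_nat_tendsto_0:
  fixes x :: real
  assumes "0 < x"
  shows "(\<lambda>n. Polygamma 1 (x + real n)) \<longlonglongrightarrow> 0"
proof -
  have "(\<lambda>k. inverse ((x + real k) ^ Suc 1)) sums Polygamma 1 x"
    using Polygamma_LIMSEQ[of x 1] assms by auto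
  then have "(\<lambda>n. Polygamma 1 x - (\<Sum>k<n. inverse ((x + real k) ^ Suc 1))) \<longlonglongrightarrow> Polygamma 1 x - Polygamma 1 x"
    unfolding sums_def by (intro tendsto_intros)
  moreover have "Polygamma 1 (x + real n) = Polygamma 1 x - (\<Sum>k<n. inverse ((x + real k) ^ Suc 1))" for n
    using Polygamma_plus_of_nat[of n x 1] assms by (auto simp: field_simps)
  ultimately show ?thesis by simp
qed

section \<open>Stirling's formula: independence of x and value of the limit\<close>

definition stirling_remainder :: "real \<Rightarrow> real" where
  "stirling_remainder x = ln_Gamma x - (x - 1 / 2) * ln x + x"

lemma ln_Gamma_plus1:
  fixes x :: real
  assumes "0 < x"
  shows "ln_Gamma (x + 1) = ln_Gamma x + ln x"
proof -
  have "Gamma (x + 1) = x * Gamma x"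
    using assms by (intro Gamma_plus1) auto
  then show ?thesis
    using assms Gamma_real_nonzero[OF assms] by (simp add: ln_Gamma_real_pos ln_mult)
qed

lemma stirling_remainder_plus1:
  assumes "0 < x"
  shows "stirling_remainder (x + 1) - stirling_remainder x = 1 - (x + 1 / 2) * (ln (x + 1) - ln x)"
  using assms ln_Gamma_plus1[OF assms] by (simp add: stirling_remainder_def algebra_simps)

lemma stirling_remainder_shift:
  assumes "0 < x"
  shows "(\<lambda>n. stirling_remainder (x + real n) - stirling_remainder (real n)) \<longlonglongrightarrow> 0"
proof -
  \<comment> \<open>This is the elementary part of the difference left after the expression of
    \<open>ln_Gamma_plus_nat_asymp\<close> is split off.\<close>
  have "(\<lambda>n. x + x * ln (real n) - (x + real n - 1 / 2) * ln (x + real n)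
      + (real n - 1 / 2) * ln (real n)) \<longlonglongrightarrow> 0"
    using assms by real_asymp
  from tendsto_add[OF ln_Gamma_plus_nat_asymp[OF assms] this] show ?thesis
    by (simp add: stirling_remainder_def algebra_simps)
qed

text \<open>Along n, n + 1/2 and 2n the limit is the same c, so the sum of the first two minus the
  third tends to c. Duplication at n removes every Gamma value from that combination and leaves an
  elementary limit.\<close>

lemma stirling_remainder_limit_value:
  assumes "(\<lambda>n. stirling_remainder (real n)) \<longlonglongrightarrow> c"
  shows "c = ln (2 * pi) / 2"
proof -
  have half: "(\<lambda>n. stirling_remainder (1 / 2 + real n)) \<longlonglongrightarrow> c"
    using tendsto_add[OF stirling_remainder_shift[of "1 / 2"] assms] by simp
  have double: "(\<lambda>n. stirling_remainder (real (2 * n))) \<longlonglongrightarrow> c"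
    using filterlim_compose[OF assms, of "\<lambda>n. 2 * n"] filterlim_subseq[of "\<lambda>n. 2 * n"]
    by (simp add: strict_mono_def)
  have "(\<lambda>n. stirling_remainder (real n) + stirling_remainder (1 / 2 + real n)
      - stirling_remainder (real (2 * n))) \<longlonglongrightarrow> c + c - c"
    by (intro tendsto_intros assms half double)
  moreover have "(\<lambda>n. stirling_remainder (real n) + stirling_remainder (1 / 2 + real n)
      - stirling_remainder (real (2 * n))) \<longlonglongrightarrow> ln (2 * pi) / 2"
  proof (rule Lim_transform_eventually)
    show "(\<lambda>n. (1 - 2 * real n) * ln 2 + ln pi / 2 - (real n - 1 / 2) * ln (real n) - real n * ln (1 / 2 + real n)
      + 1 / 2 + (2 * real n - 1 / 2) * ln (2 * real n)) \<longlonglongrightarrow> ln (2 * pi) / 2"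
      by (real_asymp simp: ln_mult)
    show "\<forall>\<^sub>F n in sequentially. (1 - 2 * real n) * ln 2 + ln pi / 2 - (real n - 1 / 2) * ln (real n)
      - real n * ln (1 / 2 + real n) + 1 / 2 + (2 * real n - 1 / 2) * ln (2 * real n)
      = stirling_remainder (real n) + stirling_remainder (1 / 2 + real n)
      - stirling_remainder (real (2 * n))"
      using eventually_gt_at_top[of 0]
    proof eventually_elim
      case (elim n)
      then show ?case
        using ln_Gamma_legendre_duplication[of "real n"]
        by (simp add: stirling_remainder_def algebra_simps)
    qed
  qed
  ultimately show ?thesis using LIMSEQ_unique by fastforce
qed

text \<open>For x > 0 this is the logarithm of the quotient in the theorem; the factor x in Gamma(x
  + 1) = x Gamma(x) is absorbed into the coefficient x - 1/2 of ln x.\<close>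

definition trigamma_remainder :: "real \<Rightarrow> real" where
  "trigamma_remainder x = stirling_remainder x - ln (2 * pi) / 2 - Polygamma 1 (x + 1 / 2) / 12"

section \<open>Increments of the remainder and of the correction terms\<close>

lemma trigamma_remainder_plus1:
  assumes "0 < x" and u: "u = 1 / (2 * x + 1)"
  shows "trigamma_remainder (x + 1) - trigamma_remainder x
    = (2 * u + 2 * u ^ 3 / 3 - (ln (1 + u) - ln (1 - u))) / (2 * u)"
proof -
  \<comment> \<open>In this variable (x + 1) / x is (1 + u) / (1 - u), and the trigamma step 1 / (x
    + 1/2)^2 is 4 u^2. The weight 1/12 then produces exactly the cubic Taylor term.\<close>
  have x: "x = (1 - u) / (2 * u)" "x + 1 = (1 + u) / (2 * u)" "x + 1 / 2 = 1 / (2 * u)"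
    and u': "0 < u" "u < 1"
    using assms(1) by (auto simp: u field_simps)
  have "ln (x + 1) - ln x = ln (1 + u) - ln (1 - u)"
    unfolding x(2) using u' by (simp add: x(1) ln_div)
  then have "stirling_remainder (x + 1) - stirling_remainder x
      = 1 - 1 / (2 * u) * (ln (1 + u) - ln (1 - u))"
    using stirling_remainder_plus1[OF assms(1)] x(3) by simp
  moreover have "Polygamma 1 (x + 1 / 2 + 1) = Polygamma 1 (x + 1 / 2) - 4 * u\<^sup>2"
    using Polygamma_plus1[of "x + 1 / 2" 1] assms(1) u'
    by (simp add: x(3) power2_eq_square)
  then have "Polygamma 1 (x + 1 + 1 / 2) = Polygamma 1 (x + 1 / 2) - 4 * u\<^sup>2"
    by (simp add: add_ac)
  ultimately have "trigamma_remainder (x + 1) - trigamma_remainder x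
      = 1 - 1 / (2 * u) * (ln (1 + u) - ln (1 - u)) + u\<^sup>2 / 3"
    by (simp add: trigamma_remainder_def diff_divide_distrib)
  also have "\<dots> = (2 * u + 2 * u ^ 3 / 3 - (ln (1 + u) - ln (1 - u))) / (2 * u)"
    using u' by (simp add: field_simps eval_nat_numeral)
  finally show ?thesis .
qed

text \<open>Substituting 1/x = 2u / (1 - u) and 1/(x + 1) = 2u / (1 + u) turns the increments of the
  corrections into the rational terms of the logarithm bounds.\<close>

lemma reciprocal_power_differences:
  fixes x :: real
  assumes "0 < x" and u: "u = 1 / (2 * x + 1)"
  shows "2 * u * (1 / (240 * x ^ 3) - 1 / (240 * (x + 1) ^ 3))
      = (6 * u ^ 5 + 2 * u ^ 7) / (1 - u\<^sup>2) ^ 3 / 15"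
    and "2 * u * (11 / (6720 * x ^ 5) - 11 / (6720 * (x + 1) ^ 5))
      = (110 * u ^ 7 + 220 * u ^ 9 + 22 * u ^ 11) / (1 - u\<^sup>2) ^ 5 / 105"
proof -
  have x: "x = (1 - u) / (2 * u)" "x + 1 = (1 + u) / (2 * u)" and u': "0 < u" "u < 1"
    using assms(1) by (auto simp: u field_simps)
  have d: "1 - u\<^sup>2 = (1 - u) * (1 + u)" by (simp add: power2_eq_square algebra_simps)
  define a b where ab: "a = 1 - u" "b = 1 + u"
  have pos: "a > 0" "b > 0" using u' by (simp_all add: ab)
  have inv: "1 / x = 2 * u / a" "1 / (x + 1) = 2 * u / b"
    unfolding x(2) unfolding x(1) using u' by (simp_all add: ab)
  have "2 * u * (1 / (240 * x ^ 3) - 1 / (240 * (x + 1) ^ 3))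
    = u / 120 * ((1 / x) ^ 3 - (1 / (x + 1)) ^ 3)"
    by (simp add: field_simps)
  also have "\<dots> = u ^ 4 / 15 * (b ^ 3 - a ^ 3) / (a * b) ^ 3"
    unfolding inv using pos by (simp add: field_simps eval_nat_numeral)
  also have "b ^ 3 - a ^ 3 = 6 * u + 2 * u ^ 3" unfolding ab by algebra
  also have "u ^ 4 / 15 * (6 * u + 2 * u ^ 3) = (6 * u ^ 5 + 2 * u ^ 7) / 15"
    by (simp add: field_simps eval_nat_numeral)
  also have "\<dots> / (a * b) ^ 3 = (6 * u ^ 5 + 2 * u ^ 7) / (1 - u\<^sup>2) ^ 3 / 15"
    by (simp add: d ab)
  finally show "2 * u * (1 / (240 * x ^ 3) - 1 / (240 * (x + 1) ^ 3))
      = (6 * u ^ 5 + 2 * u ^ 7) / (1 - u\<^sup>2) ^ 3 / 15" .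
  have "2 * u * (11 / (6720 * x ^ 5) - 11 / (6720 * (x + 1) ^ 5))
    = 11 * u / 3360 * ((1 / x) ^ 5 - (1 / (x + 1)) ^ 5)"
    by (simp add: field_simps)
  also have "\<dots> = 11 * u ^ 6 / 105 * (b ^ 5 - a ^ 5) / (a * b) ^ 5"
    unfolding inv using pos by (simp add: field_simps eval_nat_numeral)
  also have "b ^ 5 - a ^ 5 = 10 * u + 20 * u ^ 3 + 2 * u ^ 5" unfolding ab by algebra
  also have "11 * u ^ 6 / 105 * (10 * u + 20 * u ^ 3 + 2 * u ^ 5)
    = (110 * u ^ 7 + 220 * u ^ 9 + 22 * u ^ 11) / 105"
    by (simp add: field_simps eval_nat_numeral)
  also have "\<dots> / (a * b) ^ 5 = (110 * u ^ 7 + 220 * u ^ 9 + 22 * u ^ 11) / (1 - u\<^sup>2) ^ 5 / 105"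
    by (simp add: d ab)
  finally show "2 * u * (11 / (6720 * x ^ 5) - 11 / (6720 * (x + 1) ^ 5))
      = (110 * u ^ 7 + 220 * u ^ 9 + 22 * u ^ 11) / (1 - u\<^sup>2) ^ 5 / 105" .
qed

text \<open>After multiplication by 2u > 0, the three claims become the three bounds for ln (1 + u)
  - ln (1 - u). The first serves convergence along the integers; the other two also drive the final
  estimates.\<close>

lemma trigamma_remainder_step:
  assumes "0 < x"
  shows "trigamma_remainder (x + 1) < trigamma_remainder x" (is ?decreasing)
    and "trigamma_remainder x - 1 / (240 * x ^ 3)
      < trigamma_remainder (x + 1) - 1 / (240 * (x + 1) ^ 3)" (is ?upper)
    and "trigamma_remainder (x + 1) - 1 / (240 * (x + 1) ^ 3) + 11 / (6720 * (x + 1) ^ 5)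
      < trigamma_remainder x - 1 / (240 * x ^ 3) + 11 / (6720 * x ^ 5)" (is ?lower)
proof -
  define u where u: "u = 1 / (2 * x + 1)"
  have u': "0 < u" "u < 1" using assms by (auto simp: u)
  have "2 * u * (trigamma_remainder (x + 1) - trigamma_remainder x)
      = 2 * u + 2 * u ^ 3 / 3 - (ln (1 + u) - ln (1 - u))"
    using trigamma_remainder_plus1[OF assms u] u' by simp
  note step = this reciprocal_power_differences[OF assms u]
  have "2 * u * (trigamma_remainder (x + 1) - trigamma_remainder x) < 0"
    unfolding step using ln_diff_cubic_lower[OF u'] by simp
  with u' show ?decreasing by (simp add: mult_less_0_iff)
  have "0 < 2 * u * (trigamma_remainder (x + 1) - trigamma_remainder x)
      + 2 * u * (1 / (240 * x ^ 3) - 1 / (240 * (x + 1) ^ 3))"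
    unfolding step using ln_diff_upper[OF u'] by simp
  also have "\<dots> = 2 * u * ((trigamma_remainder (x + 1) - trigamma_remainder x)
      + (1 / (240 * x ^ 3) - 1 / (240 * (x + 1) ^ 3)))"
    by (simp only: distrib_left)
  finally show ?upper using u' by (simp add: zero_less_mult_iff)
  have "2 * u * (trigamma_remainder (x + 1) - trigamma_remainder x)
      + 2 * u * (1 / (240 * x ^ 3) - 1 / (240 * (x + 1) ^ 3))
      - 2 * u * (11 / (6720 * x ^ 5) - 11 / (6720 * (x + 1) ^ 5)) < 0"
    unfolding step using ln_diff_lower[OF u'] by simp
  also have "2 * u * (trigamma_remainder (x + 1) - trigamma_remainder x)
      + 2 * u * (1 / (240 * x ^ 3) - 1 / (240 * (x + 1) ^ 3))
      - 2 * u * (11 / (6720 * x ^ 5) - 11 / (6720 * (x + 1) ^ 5))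
    = 2 * u * ((trigamma_remainder (x + 1) - trigamma_remainder x)
      + (1 / (240 * x ^ 3) - 1 / (240 * (x + 1) ^ 3))
      - (11 / (6720 * x ^ 5) - 11 / (6720 * (x + 1) ^ 5)))"
    by (simp only: distrib_left right_diff_distrib)
  finally show ?lower using u' by (simp add: mult_less_0_iff)
qed

section \<open>Vanishing of the remainder at infinity and the final bounds\<close>

lemma trigamma_remainder_nat_tendsto_0: "(\<lambda>n. trigamma_remainder (real n)) \<longlonglongrightarrow> 0"
proof -
  \<comment> \<open>The index starts at 1 because the step inequalities require a positive
    argument.\<close>
  let ?f = "\<lambda>n. trigamma_remainder (real (Suc n))"
  have "?f (Suc n) \<le> ?f n" for n
    using trigamma_remainder_step(1)[of "real (Suc n)"] by (simp add: add_ac less_imp_le)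
  then have "decseq ?f"
    by (rule decseq_SucI)
  \<comment> \<open>The sequence with its positive correction subtracted increases, so its first
    value bounds \<open>?f\<close> from below.\<close>
  moreover have "trigamma_remainder 1 - 1 / 240 \<le> ?f n" for n
  proof -
    have "incseq (\<lambda>n. ?f n - 1 / (240 * real (Suc n) ^ 3))"
    proof (rule incseq_SucI)
      show "?f n - 1 / (240 * real (Suc n) ^ 3) \<le> ?f (Suc n) - 1 / (240 * real (Suc (Suc n)) ^ 3)" for n
        using trigamma_remainder_step(2)[of "real (Suc n)"] by (simp add: add_ac less_imp_le)
    qed
    from incseqD[OF this, of 0 n]
    have "trigamma_remainder 1 - 1 / 240 \<le> ?f n - 1 / (240 * real (Suc n) ^ 3)" by simp
    moreover have "0 \<le> 1 / (240 * real (Suc n) ^ 3)" by simp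
    ultimately show ?thesis by linarith
  qed
  ultimately obtain c where "?f \<longlonglongrightarrow> c"
    using decseq_convergent by blast
  then have c: "(\<lambda>n. trigamma_remainder (real n)) \<longlonglongrightarrow> c"
    by (rule LIMSEQ_imp_Suc)
  \<comment> \<open>Adding back the constant and the vanishing trigamma term makes the Stirling
    remainder converge, and its known limit forces c = 0.\<close>
  have "(\<lambda>n. trigamma_remainder (real n) + ln (2 * pi) / 2 + Polygamma 1 (1 / 2 + real n) / 12)
      \<longlonglongrightarrow> c + ln (2 * pi) / 2 + 0 / 12"
    by (intro tendsto_intros c Polygamma_1_plus_nat_tendsto_0) simp_all
  then have "(\<lambda>n. stirling_remainder (real n)) \<longlonglongrightarrow> c + ln (2 * pi) / 2"
    by (simp add: trigamma_remainder_def add_ac)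
  from stirling_remainder_limit_value[OF this] have "c = 0" by simp
  with c show ?thesis by simp
qed

text \<open>The limit along the integers carries over to x + n, since the Stirling remainders differ
  by a null sequence and both trigamma terms vanish.\<close>

lemma trigamma_remainder_plus_nat_tendsto_0:
  assumes "0 < x"
  shows "(\<lambda>n. trigamma_remainder (x + real n)) \<longlonglongrightarrow> 0"
proof -
  have "(\<lambda>n. (stirling_remainder (x + real n) - stirling_remainder (real n))
      + trigamma_remainder (real n) + Polygamma 1 (1 / 2 + real n) / 12
      - Polygamma 1 (x + 1 / 2 + real n) / 12) \<longlonglongrightarrow> 0 + 0 + 0 / 12 - 0 / 12"
    using assms by (intro tendsto_intros stirling_remainder_shift
      trigamma_remainder_nat_tendsto_0 Polygamma_1_plus_nat_tendsto_0) simp_all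
  then show ?thesis
    by (simp add: trigamma_remainder_def add_ac)
qed

lemma trigamma_remainder_bounds:
  assumes "0 < x"
  shows "1 / (240 * x ^ 3) - 11 / (6720 * x ^ 5) < trigamma_remainder x"
    and "trigamma_remainder x < 1 / (240 * x ^ 3)"
proof -
  let ?g = "\<lambda>n. trigamma_remainder (x + real n) - 1 / (240 * (x + real n) ^ 3)"
  let ?h = "\<lambda>n. ?g n + 11 / (6720 * (x + real n) ^ 5)"
  have 3: "(\<lambda>n. 1 / (240 * (x + real n) ^ 3)) \<longlonglongrightarrow> 0"
    and 5: "(\<lambda>n. 11 / (6720 * (x + real n) ^ 5)) \<longlonglongrightarrow> 0"
    by real_asymp+
  have g: "?g \<longlonglongrightarrow> 0"
    using tendsto_diff[OF trigamma_remainder_plus_nat_tendsto_0[OF assms] 3] by simp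
  have h: "?h \<longlonglongrightarrow> 0"
    using tendsto_add[OF g 5] by simp
  have gS: "?g n < ?g (Suc n)" and hS: "?h (Suc n) < ?h n" for n
    using trigamma_remainder_step(2,3)[of "x + real n"] assms by (simp_all add: add_ac)
  have "incseq ?g" and "decseq ?h"
    using gS hS by (blast intro: incseq_SucI decseq_SucI less_imp_le)+
  \<comment> \<open>Limits give only weak inequalities; comparing at index 1 lets the strict step
    from 0 to 1 make the bounds at x strict.\<close>
  then have "?g (Suc 0) \<le> 0" "0 \<le> ?h (Suc 0)"
    using incseq_le[OF _ g] decseq_ge[OF _ h] by blast+
  with gS[of 0] hS[of 0] show "1 / (240 * x ^ 3) - 11 / (6720 * x ^ 5) < trigamma_remainder x"
    and "trigamma_remainder x < 1 / (240 * x ^ 3)"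
    by simp_all
qed

lemma Gamma_quotient_eq_exp_trigamma_remainder:
  fixes x :: real
  assumes "0 < x"
  shows "(exp x * Gamma (x + 1)) / (x powr x * sqrt (2 * pi * x) * exp (1 / 12 * deriv Digamma (x + 1 / 2)))
    = exp (trigamma_remainder x)"
proof -
  have "deriv Digamma (x + 1 / 2) = Polygamma 1 (x + 1 / 2)"
    using assms by (subst deriv_Polygamma) auto
  moreover have "Gamma (x + 1) = exp (ln_Gamma x + ln x)"
    using assms by (simp add: Gamma_real_pos_exp ln_Gamma_plus1)
  moreover have "x powr x = exp (x * ln x)"
    using assms by (simp add: powr_def)
  moreover have "sqrt (2 * pi * x) = exp (ln (sqrt (2 * pi * x)))"
    using assms by simp
  \<comment> \<open>\<open>exp_ln\<close> is removed from the simpset so that the exponential of the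
    logarithm does not collapse before the logarithm is expanded.\<close>
  then have "sqrt (2 * pi * x) = exp (ln (2 * pi) / 2 + ln x / 2)"
    using assms by (simp add: ln_sqrt ln_mult add_divide_distrib del: exp_ln)
  ultimately have "(exp x * Gamma (x + 1)) / (x powr x * sqrt (2 * pi * x) * exp (1 / 12 * deriv Digamma (x + 1 / 2)))
    = exp (x + (ln_Gamma x + ln x)
        - (x * ln x + (ln (2 * pi) / 2 + ln x / 2) + 1 / 12 * Polygamma 1 (x + 1 / 2)))"
    by (simp only: exp_add exp_diff)
  also have "\<dots> = exp (trigamma_remainder x)"
    by (simp add: trigamma_remainder_def stirling_remainder_def algebra_simps)
  finally show ?thesis .
qed

theorem theorem3p2:
  fixes x :: real
  assumes "x \<ge> 1"
  shows "exp (1 / (240 * x ^ 3) - 11 / (6720 * x ^ 5))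
           < (exp x * Gamma (x + 1)) / (x powr x * sqrt (2 * pi * x) * exp (1 / 12 * deriv Digamma (x + 1 / 2)))
       \<and> (exp x * Gamma (x + 1)) / (x powr x * sqrt (2 * pi * x) * exp (1 / 12 * deriv Digamma (x + 1 / 2)))
           < exp (1 / (240 * x ^ 3))"
proof -
  have "0 < x" using assms by simp
  from trigamma_remainder_bounds[OF this] show ?thesis
    unfolding Gamma_quotient_eq_exp_trigamma_remainder[OF \<open>0 < x\<close>] by simp
qed

end
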